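(* Let $(\mathcal{T},d)$ be a countable metric space, $t_0\in\mathcal{T}$, and let $X_1,\dots,X_n$ be independent random elements of $L_\infty(\mathcal{T})$, $X_i=(X_i(t))_{t\in\mathcal{T}}$. Let $S\in\mathbb{N}$, and let the sets $\mathcal{G}_s$, the maps $t\mapsto w(t,s)$, and the quantities $H_s$, $d_j(s)$, $\bar X_n$, $\bar\delta_n$ be as in the context. Assume that for each $t,\tilde t\in\mathcal{T}$ and all $\lambda>0$, $$\mathbb{E}\exp\Big[\lambda\Big|\sum_{i=1}^n(X_i(t)-X_i(\tilde t))\Big|\Big]\le2\exp\Big[\frac{n\lambda^2d^2(t,\tilde t)}{2}\Big].$$ Then for all $a>0$ $$\mathbb{P}\Big(\|\bar X_n-\bar X_n(t_0)\|_\infty\ge\gamma_n(a,S)+\|\bar\delta_n(\cdot,S)\|_\infty\Big)\le\exp[-a],$$ where $$\gamma_n(a,S):=\max_{j\in\mathcal{G}_S}\sum_{s=1}^Sd_j(s)\sqrt{\frac{2H_s+2(1+s)(1+a)}{n}} .$$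
   Context: $\{\mathcal{G}_s\}_{s\in\mathbb{N}}$ is a sequence of finite non-empty subsets of $\mathcal{T}$ and $\mathcal{G}_0=\{t_0\}$. For $s=0,\dots,S$, $t\mapsto w(t,s)\in\mathcal{G}_s$ are maps defined on $\mathcal{T}$. Define $$H_s:=\log(2|\mathcal{G}_s|),\quad s=1,\dots,S,\qquad d_j(s):=d(w(j,s),w(j,s-1)),\quad j\in\mathcal{G}_S,\ s=1,\dots,S,$$ $$\bar X_n(t):=\frac1n\sum_{i=1}^nX_i(t),\qquad\bar\delta_n(t,S):=\bar X_n(t)-\bar X_n(w(t,S)).$$ For a function $f$ on $\mathcal{T}$, $\|f\|_\infty:=\sup_{t\in\mathcal{T}}|f(t)|$; thus $\|\bar X_n-\bar X_n(t_0)\|_\infty=\sup_{t\in\mathcal{T}}|\bar X_n(t)-\bar X_n(t_0)|$.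
   Formalization: The formal theorem adds two hypotheses, without which the claim fails: w(w(t,S),S)=w(t,S) for all t (chains for j in G_S end consistently), and some d_j(s)>0 with j in G_S, 1≤s≤S (so γ_n>0; otherwise, e.g. all G_s={t_0}, the event is certain). Also n,S≥1. *)

theory Defs
  imports "HOL-Probability.Probability" "HOL-Analysis.Abstract_Metric_Spaces"
begin

text \<open>The bounded real functions on \<open>T\<close> (extensional outside \<open>T\<close>), with the \<open>\<sigma>\<close>-algebra generated
  by the evaluations.  Every sup-norm Borel random element is measurable for it.\<close>

definition Linf :: "'a set \<Rightarrow> ('a \<Rightarrow> real) measure" where
  "Linf T = restrict_space (PiM T (\<lambda>_. borel)) {f. bounded (f ` T)}"

definition sup_norm :: "'a set \<Rightarrow> ('a \<Rightarrow> real) \<Rightarrow> real" where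
  "sup_norm T f = (SUP t\<in>T. \<bar>f t\<bar>)"

definition entropy :: "(nat \<Rightarrow> 'a set) \<Rightarrow> nat \<Rightarrow> real" where
  "entropy G s = ln (2 * real (card (G s)))"

definition link :: "('a \<Rightarrow> 'a \<Rightarrow> real) \<Rightarrow> ('a \<Rightarrow> nat \<Rightarrow> 'a) \<Rightarrow> 'a \<Rightarrow> nat \<Rightarrow> real" where
  "link d w j s = d (w j s) (w j (s - 1))"

definition avg :: "nat \<Rightarrow> (nat \<Rightarrow> 'w \<Rightarrow> 'a \<Rightarrow> real) \<Rightarrow> 'w \<Rightarrow> 'a \<Rightarrow> real" where
  "avg n X \<omega> t = 1 / real n * (\<Sum>i=1..n. X i \<omega> t)"

definition remainder ::
  "nat \<Rightarrow> (nat \<Rightarrow> 'w \<Rightarrow> 'a \<Rightarrow> real) \<Rightarrow> ('a \<Rightarrow> nat \<Rightarrow> 'a) \<Rightarrow> nat \<Rightarrow> 'w \<Rightarrow> 'a \<Rightarrow> real" where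
  "remainder n X w S \<omega> t = avg n X \<omega> t - avg n X \<omega> (w t S)"

definition chain_gamma ::
  "('a \<Rightarrow> 'a \<Rightarrow> real) \<Rightarrow> (nat \<Rightarrow> 'a set) \<Rightarrow> ('a \<Rightarrow> nat \<Rightarrow> 'a) \<Rightarrow> nat \<Rightarrow> real \<Rightarrow> nat \<Rightarrow> real" where
  "chain_gamma d G w n a S =
     Max ((\<lambda>j. \<Sum>s=1..S. link d w j s *
       sqrt ((2 * entropy G s + 2 * (1 + real s) * (1 + a)) / real n)) ` G S)"

end

theory Submission
  imports Defs
begin

text \<open>The number of links between \<open>G s\<close> and \<open>G (s - 1)\<close> that occur in the given chains may
  exceed \<open>card (G s)\<close>, because \<open>w j (s - 1)\<close> need not be a function of \<open>w j s\<close>; a union bound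
  over all these links would not give the stated entropy term.  Instead, charge the link from \<open>p\<close>
  to \<open>q\<close> at level \<open>s\<close> its contribution \<open>c\<^sub>s d(p, q)\<close> to \<open>\<gamma>\<close> and give each \<open>p\<close> in
  \<open>G s\<close> the predecessor in \<open>G (s - 1)\<close> on a cheapest path to \<open>t\<^sub>0\<close>.  These new chains have
  exactly one link per point of \<open>G s\<close>, so Chernoff's bound and a union bound control all of them
  outside an event of probability at most \<open>\<Sum>\<^sub>s exp (-(1 + s) (1 + a)) \<le> exp (-a)\<close>, and they are
  no more expensive than the original ones.\<close>

primrec path_cost :: "(nat \<Rightarrow> 'a \<Rightarrow> 'a \<Rightarrow> real) \<Rightarrow> (nat \<Rightarrow> 'a set) \<Rightarrow> nat \<Rightarrow> 'a \<Rightarrow> real" where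
  "path_cost k G 0 p = 0"
| "path_cost k G (Suc s) p = Min ((\<lambda>q. path_cost k G s q + k (Suc s) p q) ` G s)"

lemma path_cost_attained:
  assumes "finite (G s)" and "G s \<noteq> {}"
  obtains q where "q \<in> G s" and "path_cost k G (Suc s) p = path_cost k G s q + k (Suc s) p q"
proof -
  have "path_cost k G (Suc s) p \<in> (\<lambda>q. path_cost k G s q + k (Suc s) p q) ` G s"
    unfolding path_cost.simps by (rule Min_in) (use assms in auto)
  then show ?thesis using that by blast
qed

text \<open>Any chain through the levels is a candidate in every minimum. The endpoint
  \<open>v s\<close> is unconstrained, since only its predecessors range over the sets
  \<open>G i\<close>. This is how the cheapest paths get compared with the given chains.\<close>

lemma path_cost_le_sum:
  assumes "\<And>i. i < s \<Longrightarrow> finite (G i)" and "\<And>i. i < s \<Longrightarrow> v i \<in> G i"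
  shows "path_cost k G s (v s) \<le> (\<Sum>i=1..s. k i (v i) (v (i - 1)))"
  using assms
proof (induction s)
  case 0
  then show ?case by simp
next
  case (Suc s)
  have "path_cost k G (Suc s) (v (Suc s)) \<le> path_cost k G s (v s) + k (Suc s) (v (Suc s)) (v s)"
    unfolding path_cost.simps by (rule Min_le) (use Suc.prems in auto)
  also have "path_cost k G s (v s) \<le> (\<Sum>i=1..s. k i (v i) (v (i - 1)))"
    using Suc by simp
  finally show ?case by simp
qed

lemma path_cost_nonneg:
  assumes "\<And>i. i < s \<Longrightarrow> finite (G i) \<and> G i \<noteq> {}" and "\<And>i p q. 0 \<le> k i p q"
  shows "0 \<le> path_cost k G s p"
  using assms(1)
proof (induction s arbitrary: p)
  case (Suc s)
  obtain q where "path_cost k G (Suc s) p = path_cost k G s q + k (Suc s) p q"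
    using path_cost_attained[of G s k p] Suc.prems by blast
  with Suc assms(2) show ?case by simp
qed simp

text \<open>The trivial alternative in the conclusion accounts for paths that never leave \<open>t0\<close>, for
  which the strict inequality fails.\<close>

lemma increment_less_path_cost:
  fixes f :: "'a \<Rightarrow> real"
  assumes G: "\<And>i. i < s \<Longrightarrow> finite (G i) \<and> G i \<noteq> {}" and G0: "G 0 = {t0}"
    and k: "\<And>i p q. 0 \<le> k i p q"
    and pred: "\<And>i p. i < s \<Longrightarrow> p \<in> G (Suc i) \<Longrightarrow> pred i p \<in> G i \<and>
      path_cost k G (Suc i) p = path_cost k G i (pred i p) + k (Suc i) p (pred i p)"
    and link: "\<And>i p. i < s \<Longrightarrow> p \<in> G (Suc i) \<Longrightarrow> pred i p \<noteq> p \<Longrightarrow>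
      \<bar>f p - f (pred i p)\<bar> < k (Suc i) p (pred i p)"
    and p: "p \<in> G s"
  shows "\<bar>f p - f t0\<bar> < path_cost k G s p \<or> f p = f t0"
  using G pred link p
proof (induction s arbitrary: p)
  case 0
  then show ?case using G0 by simp
next
  case (Suc s)
  define q where "q = pred s p"
  have q: "q \<in> G s" "path_cost k G (Suc s) p = path_cost k G s q + k (Suc s) p q"
    using Suc.prems(2)[of s p] Suc.prems(4) by (auto simp: q_def)
  have IH: "\<bar>f q - f t0\<bar> < path_cost k G s q \<or> f q = f t0"
    by (rule Suc.IH) (use Suc.prems q(1) in auto)
  show ?case
  proof (cases "q = p")
    case True
    then show ?thesis using IH q(2) k[of "Suc s" p p] by auto
  next
    case False
    then have "\<bar>f p - f q\<bar> < k (Suc s) p q"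
      using Suc.prems(3)[of s p] Suc.prems(4) by (auto simp: q_def)
    \<comment> \<open>Serves the alternative \<open>f q = f t0\<close>: the strict link bound alone
      then gives the strict inequality for \<open>p\<close>.\<close>
    moreover have "0 \<le> path_cost k G s q"
      by (rule path_cost_nonneg) (use Suc.prems(1) k in auto)
    ultimately show ?thesis using IH q(2) by linarith
  qed
qed

section \<open>Tail bound, geometric sum and regularity of the process\<close>

lemma (in prob_space) subgaussian_tail:
  fixes Y :: "'a \<Rightarrow> real"
  assumes Y [measurable]: "Y \<in> borel_measurable M" and "0 < v" and "0 < u"
    and mgf: "\<And>l. 0 < l \<Longrightarrow>
      (\<integral>\<^sup>+\<omega>. ennreal (exp (l * \<bar>Y \<omega>\<bar>)) \<partial>M) \<le> ennreal (2 * exp (l\<^sup>2 * v / 2))"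
  shows "prob {\<omega> \<in> space M. u \<le> \<bar>Y \<omega>\<bar>} \<le> 2 * exp (- (u\<^sup>2 / (2 * v)))"
proof -
  \<comment> \<open>The minimiser of the Chernoff exponent
    \<open>l\<^sup>2 * v / 2 - l * u\<close>.\<close>
  define l where "l = u / v"
  have l: "0 < l" using assms by (simp add: l_def)
  have "emeasure M {\<omega> \<in> space M. u \<le> \<bar>Y \<omega>\<bar>}
      \<le> ennreal (exp (- (l * u))) * (\<integral>\<^sup>+\<omega>. ennreal (exp (l * \<bar>Y \<omega>\<bar>)) \<partial>M)"
    using Chernoff_ineq_nn_integral_ge[OF l, of "space M" M "\<lambda>\<omega>. \<bar>Y \<omega>\<bar>" u]
    by (simp add: nn_set_integral_space)
  also have "\<dots> \<le> ennreal (exp (- (l * u))) * ennreal (2 * exp (l\<^sup>2 * v / 2))"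
    by (intro mult_left_mono mgf l) simp
  also have "\<dots> = ennreal (2 * (exp (- (l * u)) * exp (l\<^sup>2 * v / 2)))"
    by (simp add: ennreal_mult'[symmetric] ac_simps)
  also have "exp (- (l * u)) * exp (l\<^sup>2 * v / 2) = exp (- (u\<^sup>2 / (2 * v)))"
    unfolding exp_add[symmetric] using \<open>0 < v\<close>
    by (simp add: l_def field_simps power2_eq_square)
  finally show ?thesis
    by (simp add: emeasure_eq_measure)
qed

text \<open>The subtracted last power carries the induction: for \<open>x \<le> 1 / 2\<close> the
  next term is at most half of it, so a remainder of the same form is left.\<close>

lemma sum_geometric_le:
  fixes x :: real
  assumes "0 \<le> x" and "x \<le> 1 / 2"
  shows "(\<Sum>s=1..S. x ^ (1 + s)) \<le> x - x ^ (1 + S)"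
proof (induction S)
  case (Suc S)
  have "x * x ^ Suc S \<le> 1 / 2 * x ^ Suc S"
    by (rule mult_right_mono) (use assms in auto)
  then show ?case using Suc by simp
qed simp

lemma Linf_measurableD:
  assumes "Y \<in> measurable M (Linf T)"
  shows "t \<in> T \<Longrightarrow> (\<lambda>\<omega>. Y \<omega> t) \<in> borel_measurable M"
    and "\<omega> \<in> space M \<Longrightarrow> bounded (Y \<omega> ` T)"
proof -
  have *: "Y \<in> measurable M (PiM T (\<lambda>_. borel))" "Y \<in> space M \<rightarrow> {f. bounded (f ` T)}"
    using assms unfolding Linf_def by (auto simp: measurable_restrict_space2_iff)
  show "t \<in> T \<Longrightarrow> (\<lambda>\<omega>. Y \<omega> t) \<in> borel_measurable M"
    using measurable_compose[OF *(1) measurable_component_singleton[of t T "\<lambda>_. borel"]] by simp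
  show "\<omega> \<in> space M \<Longrightarrow> bounded (Y \<omega> ` T)"
    using *(2) by auto
qed

lemma bounded_avg:
  assumes "\<And>i. i \<in> {1..n} \<Longrightarrow> bounded (X i \<omega> ` T)"
  shows "bounded (avg n X \<omega> ` T)"
proof -
  have "\<forall>i\<in>{1..n}. \<exists>B. \<forall>t\<in>T. \<bar>X i \<omega> t\<bar> \<le> B"
    using assms by (auto simp: bounded_iff)
  then obtain B where B: "\<And>i t. i \<in> {1..n} \<Longrightarrow> t \<in> T \<Longrightarrow> \<bar>X i \<omega> t\<bar> \<le> B i"
    by metis
  have "\<bar>avg n X \<omega> t\<bar> \<le> 1 / real n * (\<Sum>i=1..n. B i)" if "t \<in> T" for t
    unfolding avg_def abs_mult
    by (intro mult_mono order.trans[OF sum_abs] sum_mono B that) (auto intro: sum_nonneg)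
  then show ?thesis by (auto simp: bounded_iff)
qed

theorem theorem3p7p1:
  fixes T :: "'a set" and d :: "'a \<Rightarrow> 'a \<Rightarrow> real" and t0 :: 'a
    and M :: "'w measure" and n S :: nat
    and X :: "nat \<Rightarrow> 'w \<Rightarrow> 'a \<Rightarrow> real"
    and G :: "nat \<Rightarrow> 'a set" and w :: "'a \<Rightarrow> nat \<Rightarrow> 'a"
  assumes "Metric_space T d" and "countable T" and "t0 \<in> T"
    and "prob_space M" and "n \<ge> 1" and "S \<ge> 1"
    and "prob_space.indep_vars M (\<lambda>_. Linf T) X {1..n}"
    and "\<forall>s. finite (G s) \<and> G s \<noteq> {} \<and> G s \<subseteq> T" and "G 0 = {t0}"
    and "\<forall>s\<le>S. \<forall>t\<in>T. w t s \<in> G s"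
    and retraction: "\<forall>t\<in>T. w (w t S) S = w t S"
    and nondegenerate: "\<exists>j\<in>G S. \<exists>s\<in>{1..S}. link d w j s > 0"
    and "\<forall>t\<in>T. \<forall>t'\<in>T. \<forall>l::real. l > 0 \<longrightarrow>
           (\<integral>\<^sup>+\<omega>. ennreal (exp (l * \<bar>\<Sum>i=1..n. (X i \<omega> t - X i \<omega> t')\<bar>)) \<partial>M)
             \<le> ennreal (2 * exp (real n * l\<^sup>2 * (d t t')\<^sup>2 / 2))"
  shows "\<forall>a::real. a > 0 \<longrightarrow>
           measure M {\<omega> \<in> space M.
             sup_norm T (\<lambda>t. avg n X \<omega> t - avg n X \<omega> t0)
               \<ge> chain_gamma d G w n a S + sup_norm T (remainder n X w S \<omega>)}
           \<le> exp (- a)"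
proof (intro allI impI)
  fix a :: real
  assume a: "0 < a"
  interpret Metric_space T d by fact
  interpret prob_space M by fact
  define c where "c s = sqrt ((2 * Defs.entropy G s + 2 * (1 + real s) * (1 + a)) / real n)" for s
  define k where "k s p q = c s * d p q" for s p q
  define \<gamma> where "\<gamma> = chain_gamma d G w n a S"
  define Y where "Y p q \<omega> = (\<Sum>i=1..n. X i \<omega> p - X i \<omega> q)" for p q \<omega>
  have G: "finite (G s)" "G s \<noteq> {}" "G s \<subseteq> T" for s
    using assms(8) by auto
  have card: "0 < card (G s)" for s using G by (simp add: card_gt_0_iff)
  have ent: "0 < Defs.entropy G s" for s
    using card[of s] by (simp add: Defs.entropy_def)
  have c_sq: "real n * (c s)\<^sup>2 = 2 * Defs.entropy G s + 2 * (1 + real s) * (1 + a)" for s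
    using ent[of s] a assms(5) by (simp add: c_def)
  \<comment> \<open>The factor 2 inside the logarithm keeps the entropy positive even when
    \<open>G s\<close> is a single point.\<close>
  have c_pos: "0 < c s" for s
    using ent[of s] a assms(5) unfolding c_def
    by (intro real_sqrt_gt_zero divide_pos_pos add_pos_nonneg) auto
  have k_nonneg: "0 \<le> k s p q" for s p q
    using c_pos[of s] by (simp add: k_def)
  have X: "X i \<in> measurable M (Linf T)" if "i \<in> {1..n}" for i
    using assms(7) that by (auto simp: indep_vars_def)
  have Y_meas: "Y p q \<in> borel_measurable M" if "p \<in> T" "q \<in> T" for p q
    unfolding Y_def by (intro borel_measurable_sum borel_measurable_diff Linf_measurableD(1)[OF X] that)
  have avg_diff: "avg n X \<omega> p - avg n X \<omega> q = Y p q \<omega> / real n" for p q \<omega>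
    by (simp add: avg_def Y_def sum_subtractf diff_divide_distrib)

  have "\<exists>q. q \<in> G s \<and> path_cost k G (Suc s) p = path_cost k G s q + k (Suc s) p q" for s p
    by (rule path_cost_attained[of G s k p, OF G(1,2)]) blast
  then obtain pred where pred: "\<And>s p. pred s p \<in> G s"
    "\<And>s p. path_cost k G (Suc s) p = path_cost k G s (pred s p) + k (Suc s) p (pred s p)"
    by (metis (no_types))

  \<comment> \<open>Probability that some chosen link is exceeded\<close>
  define Bad where
    "Bad s p = {\<omega> \<in> space M. real n * k (Suc s) p (pred s p) \<le> \<bar>Y p (pred s p) \<omega>\<bar>}" for s p
  \<comment> \<open>The index \<open>s\<close> stands for the link from level \<open>Suc s\<close>
    down to level \<open>s\<close>. Trivial links are left out: for them both sides of the
    inequality in \<open>Bad\<close> vanish, and the event would be all of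
    \<open>space M\<close>.\<close>
  define U where
    "U = (\<Union>(s, p)\<in>(SIGMA s:{..<S}. {p \<in> G (Suc s). pred s p \<noteq> p}). Bad s p)"
  have Bad_sets: "Bad s p \<in> sets M" if "p \<in> G (Suc s)" for s p
  proof -
    have [measurable]: "Y p (pred s p) \<in> borel_measurable M"
      using Y_meas that pred(1)[of s p] G(3) by blast
    show ?thesis unfolding Bad_def by measurable
  qed
  have prob_Bad: "prob (Bad s p) \<le> exp (- (1 + a)) ^ (1 + Suc s) / real (card (G (Suc s)))"
    if p: "p \<in> G (Suc s)" "pred s p \<noteq> p" for s p
  proof -
    define q where "q = pred s p"
    have T: "p \<in> T" "q \<in> T" using p(1) pred(1)[of s p] G(3) by (auto simp: q_def)
    have d: "0 < d p q" using T p(2) by (auto simp: q_def)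
    have "prob (Bad s p)
        \<le> 2 * exp (- ((real n * k (Suc s) p q)\<^sup>2 / (2 * (real n * (d p q)\<^sup>2))))"
      unfolding Bad_def q_def[symmetric]
    proof (rule subgaussian_tail)
      show "Y p q \<in> borel_measurable M" by (rule Y_meas[OF T])
      show "0 < real n * (d p q)\<^sup>2" "0 < real n * k (Suc s) p q"
        using d assms(5) c_pos by (auto simp: k_def)
      show "(\<integral>\<^sup>+\<omega>. ennreal (exp (l * \<bar>Y p q \<omega>\<bar>)) \<partial>M)
          \<le> ennreal (2 * exp (l\<^sup>2 * (real n * (d p q)\<^sup>2) / 2))" if "0 < l" for l
        using assms(13) T that by (simp add: Y_def ac_simps)
    qed
    \<comment> \<open>The distance cancels, as the threshold is proportional to it, so all links of
      one level share the same bound.\<close>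
    also have "(real n * k (Suc s) p q)\<^sup>2 / (2 * (real n * (d p q)\<^sup>2)) = real n * (c (Suc s))\<^sup>2 / 2"
      using d assms(5) by (simp add: k_def field_simps power2_eq_square)
    also have "\<dots> = Defs.entropy G (Suc s) + real (1 + Suc s) * (1 + a)"
      unfolding c_sq by (simp add: field_simps)
    also have "2 * exp (- \<dots>) = 2 * exp (- Defs.entropy G (Suc s)) * exp (real (1 + Suc s) * - (1 + a))"
      by (simp add: exp_add[symmetric] algebra_simps)
    \<comment> \<open>The entropy term absorbs the Chernoff factor 2 and pays for the union over at
      most \<open>card (G (Suc s))\<close> links.\<close>
    also have "2 * exp (- Defs.entropy G (Suc s)) = 1 / real (card (G (Suc s)))"
      using card[of "Suc s"] by (simp add: Defs.entropy_def exp_minus field_simps)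
    finally show ?thesis
      unfolding exp_of_nat_mult by simp
  qed
  have "prob U \<le> (\<Sum>(s, p)\<in>(SIGMA s:{..<S}. {p \<in> G (Suc s). pred s p \<noteq> p}). prob (Bad s p))"
    unfolding U_def
    by (rule order.trans[OF finite_measure_subadditive_finite]) (auto simp: G Bad_sets split_def)
  also have "\<dots> = (\<Sum>s<S. \<Sum>p | p \<in> G (Suc s) \<and> pred s p \<noteq> p. prob (Bad s p))"
    by (subst sum.Sigma) (auto simp: G)
  also have "\<dots> \<le> (\<Sum>s<S. exp (- (1 + a)) ^ (1 + Suc s))"
  proof (rule sum_mono)
    fix s
    let ?e = "exp (- (1 + a)) ^ (1 + Suc s)"
    let ?P = "{p \<in> G (Suc s). pred s p \<noteq> p}"
    have "(\<Sum>p\<in>?P. prob (Bad s p)) \<le> (\<Sum>p\<in>?P. ?e / real (card (G (Suc s))))"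
      by (rule sum_mono) (use prob_Bad in auto)
    also have "\<dots> \<le> (\<Sum>p\<in>G (Suc s). ?e / real (card (G (Suc s))))"
      by (rule sum_mono2) (auto simp: G)
    also have "\<dots> = ?e" using card[of "Suc s"] by simp
    finally show "(\<Sum>p\<in>?P. prob (Bad s p)) \<le> ?e" .
  qed
  also have "\<dots> = (\<Sum>s=1..S. exp (- (1 + a)) ^ (1 + s))"
    by (rule sum.reindex_bij_witness[of _ "\<lambda>s. s - 1" Suc]) auto
  also have "\<dots> \<le> exp (- (1 + a)) - exp (- (1 + a)) ^ (1 + S)"
  proof (rule sum_geometric_le)
    have "2 \<le> exp (1 + a)" using exp_ge_add_one_self[of "1 + a"] a by linarith
    then show "exp (- (1 + a)) \<le> 1 / 2"
      unfolding exp_minus inverse_eq_divide by (intro divide_left_mono) auto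
  qed simp
  also have "\<dots> \<le> exp (- (1 + a))" by simp
  also have "\<dots> \<le> exp (- a)" by simp
  finally have prob_U: "prob U \<le> exp (- a)" .

  \<comment> \<open>Deterministic bound outside \<open>U\<close>\<close>
  have cost: "(\<Sum>s=1..S. k s (w j s) (w j (s - 1))) \<le> \<gamma>" if "j \<in> G S" for j
    unfolding \<gamma>_def chain_gamma_def c_def[symmetric] k_def
    by (rule Max_ge) (use that G in \<open>auto simp: link_def mult.commute\<close>)
  \<comment> \<open>A link of positive length makes \<open>\<gamma>\<close> positive. If all sets
    \<open>G s\<close> were \<open>{t0}\<close>, then \<open>\<gamma>\<close> would be 0 and the
    event in question all of \<open>space M\<close>.\<close>
  obtain j s where js: "j \<in> G S" "s \<in> {1..S}" "0 < link d w j s"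
    using nondegenerate by blast
  have "0 < k s (w j s) (w j (s - 1))"
    using js(3) c_pos by (simp add: k_def link_def)
  also have "\<dots> \<le> (\<Sum>s=1..S. k s (w j s) (w j (s - 1)))"
    by (rule member_le_sum) (use js k_nonneg in auto)
  also have "\<dots> \<le> \<gamma>" by (rule cost) fact
  finally have \<gamma>_pos: "0 < \<gamma>" .

  have good: "sup_norm T (\<lambda>t. avg n X \<omega> t - avg n X \<omega> t0) < \<gamma> + sup_norm T (remainder n X w S \<omega>)"
    if \<omega>: "\<omega> \<in> space M" "\<omega> \<notin> U" for \<omega>
  proof -
    let ?f = "avg n X \<omega>"
    have step: "\<bar>?f p - ?f (pred i p)\<bar> < k (Suc i) p (pred i p)"
      if "i < S" "p \<in> G (Suc i)" "pred i p \<noteq> p" for i p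
    proof -
      have "\<omega> \<notin> Bad i p" using \<omega>(2) that by (auto simp: U_def)
      then show ?thesis using \<omega>(1) assms(5) by (simp add: avg_diff Bad_def field_simps)
    qed
    have less: "\<bar>?f (w t S) - ?f t0\<bar> < \<gamma>" if t: "t \<in> T" for t
    proof -
      let ?j = "w t S"
      have j: "?j \<in> G S" using assms(10) t by auto
      then have "?j \<in> T" using G(3) by auto
      have "\<bar>?f ?j - ?f t0\<bar> < path_cost k G S ?j \<or> ?f ?j = ?f t0"
        by (rule increment_less_path_cost[where pred = pred]) (use G assms(9) k_nonneg pred step j in auto)
      \<comment> \<open>The maximum in \<open>\<gamma>\<close> runs over the chains of points of
        \<open>G S\<close>, so the chain of \<open>?j\<close> is used and not that of
        \<open>t\<close>; by \<open>retraction\<close> it ends at \<open>?j\<close> itself.\<close>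
      moreover have "path_cost k G S (w ?j S) \<le> (\<Sum>s=1..S. k s (w ?j s) (w ?j (s - 1)))"
        by (rule path_cost_le_sum) (use G assms(10) \<open>?j \<in> T\<close> in auto)
      ultimately show ?thesis
        using cost[OF j] \<gamma>_pos retraction t by auto
    qed
    have "bounded (?f ` T)"
      using Linf_measurableD(2)[OF X \<omega>(1)] by (rule bounded_avg)
    then obtain B where B: "\<And>t. t \<in> T \<Longrightarrow> \<bar>?f t\<bar> \<le> B"
      by (auto simp: bounded_iff)
    \<comment> \<open>A real supremum dominates its terms only when they are bounded above; hence
      the appeal to bounded sample paths.\<close>
    have "\<bar>remainder n X w S \<omega> t\<bar> \<le> B + B" if "t \<in> T" for t
    proof -
      have "w t S \<in> T" using assms(10) G(3) that by blast
      then show ?thesis using B[OF that] B[of "w t S"] unfolding remainder_def by linarith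
    qed
    then have bdd: "bdd_above ((\<lambda>t. \<bar>remainder n X w S \<omega> t\<bar>) ` T)"
      by (rule bdd_aboveI2)
    \<comment> \<open>Pointwise strict bounds need not survive a supremum over infinite
      \<open>T\<close>. As \<open>w t S\<close> takes finitely many values, a maximum
      \<open>m\<close> lies strictly below \<open>\<gamma>\<close>.\<close>
    define m where "m = Max ((\<lambda>j. \<bar>?f j - ?f t0\<bar>) ` (\<lambda>t. w t S) ` T)"
    have fin: "finite ((\<lambda>t. w t S) ` T)"
      by (rule finite_subset[OF _ G(1)[of S]]) (use assms(10) in auto)
    have m: "m < \<gamma>"
      unfolding m_def using fin assms(3) less by (subst Max_less_iff) auto
    have "sup_norm T (\<lambda>t. ?f t - ?f t0) \<le> m + sup_norm T (remainder n X w S \<omega>)"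
      unfolding sup_norm_def[of T "\<lambda>t. ?f t - ?f t0"]
    proof (rule cSUP_least)
      fix t assume t: "t \<in> T"
      have "\<bar>remainder n X w S \<omega> t\<bar> \<le> sup_norm T (remainder n X w S \<omega>)"
        unfolding sup_norm_def by (rule cSUP_upper[OF t bdd])
      moreover have "\<bar>?f (w t S) - ?f t0\<bar> \<le> m"
        unfolding m_def by (rule Max_ge) (use fin t in auto)
      ultimately show "\<bar>?f t - ?f t0\<bar> \<le> m + sup_norm T (remainder n X w S \<omega>)"
        unfolding remainder_def by linarith
    qed (use assms(3) in auto)
    with m show ?thesis by linarith
  qed
  \<comment> \<open>By \<open>good\<close> the event lies inside \<open>U\<close>, and monotonicity
    asks for measurability of this larger set.\<close>
  have "U \<in> sets M"
    unfolding U_def by (rule sets.finite_UN) (auto simp: G Bad_sets)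
  then have "prob {\<omega> \<in> space M. sup_norm T (\<lambda>t. avg n X \<omega> t - avg n X \<omega> t0)
      \<ge> \<gamma> + sup_norm T (remainder n X w S \<omega>)} \<le> prob U"
    by (intro finite_measure_mono) (use good in force)
  with prob_U show "prob {\<omega> \<in> space M. sup_norm T (\<lambda>t. avg n X \<omega> t - avg n X \<omega> t0)
      \<ge> chain_gamma d G w n a S + sup_norm T (remainder n X w S \<omega>)} \<le> exp (- a)"
    unfolding \<gamma>_def by linarith
qed

end
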